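(* Let $R$ be an integral domain containing $\mathbb{Z}$. Suppose $f(x)=a_1x+a_2x^2+\cdots$ in $R[[x]]$ has compositional inverse $b_1x+b_2x^2+\cdots$ in $R[[x]]$. Then for all positive integers $m,r$, $$b_m=\frac1m\sum_{k=0}^{m-1}\binom{-m}{k}a_1^{-m-k}\mathcal{A}_{m-1,k}(a_2,a_3,\dots),$$ $$\mathcal{A}_{m,r}(b_1,b_2,\dots)=\frac rm\sum_{k=0}^{m-r}\binom{-m}{k}a_1^{-m-k}\mathcal{A}_{m-r,k}(a_2,a_3,\dots).$$
   Context: $R[[x]]$ is the ring of formal power series over $R$ (commutative). A compositional inverse of $f$ is a series $g\in R[[x]]$ without constant term with $g(f(x))=x=f(g(x))$; its existence forces $a_1$ to be invertible in $R$. The ring $R$ need not contain $\mathbb{Q}$; the equalities, with the factor $1/m$, may be read in the fraction field of $R$. Sums with upper limit less than the lower limit are $0$. For integers $n,k$ with $k\geq 0$, the De Moivre polynomial $\mathcal{A}_{n,k}(a_1,a_2,a_3,\dots)$ is the coefficient of $x^n$ in the $k$th power of the formal series without constant term with coefficients $a_j$: $$(a_1x+a_2x^2+a_3x^3+\cdots)^k=\sum_{n\in\mathbb{Z}}\mathcal{A}_{n,k}(a_1,a_2,a_3,\dots)\,x^n .$$ It is $0$ if $n<k$; if $n\geq k$ it is a polynomial with integer coefficients in $a_1,\dots,a_{n-k+1}$. Thus $\mathcal{A}_{n,k}(a_2,a_3,\dots)$ is the coefficient of $x^n$ in $(a_2x+a_3x^2+\cdots)^k$. General binomial coefficients are $\binom{z}{0}=1$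 and $\binom{z}{k}=z(z-1)\cdots(z-k+1)/k!$ for $k\geq 1$. *)

theory Defs
  imports "HOL-Computational_Algebra.Computational_Algebra"
begin

unbundle fps_syntax

lemma of_nat_fract: "(of_nat n :: 'a::idom fract) = to_fract (of_nat n)"
  by (induction n) simp_all

instance fract :: ("{idom, ring_char_0}") ring_char_0
  by standard (auto simp: inj_on_def of_nat_fract)

instance fract :: ("{idom, ring_char_0}") field_char_0 ..

definition comp_inverse_fps :: "'a::comm_ring_1 fps \<Rightarrow> 'a fps \<Rightarrow> bool" where
  "comp_inverse_fps f g \<longleftrightarrow> g $ 0 = 0 \<and> g oo f = fps_X \<and> f oo g = fps_X"

(* The variables a_1, a_2, ... are a 1, a 2, ...; the value a 0 is not used. *)
definition de_moivre :: "int \<Rightarrow> nat \<Rightarrow> (nat \<Rightarrow> 'a::comm_ring_1) \<Rightarrow> 'a" where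
  "de_moivre n k a =
     (if n < 0 then 0 else (Abs_fps (\<lambda>j. if j = 0 then 0 else a j) ^ k) $ nat n)"

end

theory Submission
  imports Defs
begin

text \<open>
  Both equalities are instances of Lagrange--Buermann inversion over the fraction field.

  Write \<open>f = x \<phi>(x)\<close> with \<open>\<phi>(0) = a\<^sub>1 \<noteq> 0\<close> and let \<open>h\<close> be any power series.  Differentiating
  \<open>h(f(x)) = \<Sum>\<^sub>n h\<^sub>n f(x)\<^sup>n\<close> and multiplying by \<open>\<phi>\<^sup>-\<^sup>m\<close> expresses the coefficient of
  \<open>x\<^sup>m\<^sup>-\<^sup>1\<close> in \<open>(h(f))' \<phi>\<^sup>-\<^sup>m\<close> as the sum of \<open>n h\<^sub>n\<close> times the coefficient of \<open>x\<^sup>m\<^sup>-\<^sup>1\<close> in \<open>f\<^sup>n\<^sup>-\<^sup>1 f' \<phi>\<^sup>-\<^sup>m\<close>.  The latter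
  is the residue of \<open>f\<^sup>n\<^sup>-\<^sup>1\<^sup>-\<^sup>m f'\<close>, so it vanishes unless \<open>n = m\<close>, when it is \<open>1\<close>; this is
  \<open>residue_deriv_mult_inverse_power\<close>, and only \<open>m h\<^sub>m\<close> survives (\<open>lagrange_buermann\<close>).
  Taking \<open>h = g\<^sup>r\<close>, where \<open>h(f(x)) = x\<^sup>r\<close>, gives
  \<open>m [x\<^sup>m] g\<^sup>r = r [x\<^sup>m\<^sup>-\<^sup>r] \<phi>\<^sup>-\<^sup>m\<close>.

  Finally \<open>\<phi> = a\<^sub>1 + (a\<^sub>2 x + a\<^sub>3 x\<^sup>2 + \<dots>)\<close>, and the binomial series expands \<open>\<phi>\<^sup>-\<^sup>m\<close> in powers of
  the bracket; the coefficients of these powers are the De Moivre polynomials in \<open>a\<^sub>2, a\<^sub>3, \<dots>\<close>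
  (\<open>inverse_power_nth_binomial\<close>).  The first equality is the case \<open>r = 1\<close>.
\<close>

text \<open>A composition is an infinite sum, but as \<open>b\<^sup>n\<close> starts no earlier than \<open>x\<^sup>n\<close>, only finitely many
  of its terms contribute to a given coefficient, even after multiplication by another series.\<close>

lemma fps_compose_mult_nth:
  fixes a b c :: "'a::comm_ring_1 fps"
  assumes "b $ 0 = 0"
  shows "((a oo b) * c) $ N = (\<Sum>n=0..N. a $ n * (b ^ n * c) $ N)"
proof -
  have ext: "(a oo b) $ i = (\<Sum>n=0..N. a $ n * (b ^ n) $ i)" if "i \<le> N" for i
    unfolding fps_compose_nth using that assms
    by (intro sum.mono_neutral_left) (auto simp: startsby_zero_power_prefix)
  have "((a oo b) * c) $ N = (\<Sum>i=0..N. (\<Sum>n=0..N. a $ n * (b ^ n) $ i) * c $ (N - i))"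
    unfolding fps_mult_nth by (intro sum.cong) (simp_all add: ext)
  also have "\<dots> = (\<Sum>n=0..N. \<Sum>i=0..N. a $ n * ((b ^ n) $ i * c $ (N - i)))"
    unfolding sum_distrib_right by (subst sum.swap) (simp add: mult.assoc)
  also have "\<dots> = (\<Sum>n=0..N. a $ n * (b ^ n * c) $ N)"
    by (simp add: fps_mult_nth sum_distrib_left)
  finally show ?thesis .
qed

text \<open>With \<open>f = x p\<close> the left-hand side is the residue of \<open>f' / f\<^sup>j\<^sup>+\<^sup>1\<close>.  For \<open>j > 0\<close> it vanishes because
  \<open>f' / f\<^sup>j\<^sup>+\<^sup>1\<close> is the derivative of the Laurent series \<open>- f\<^sup>-\<^sup>j / j\<close>; in terms of \<open>q = 1/p\<close>, the
  series \<open>j f' q\<^sup>j\<^sup>+\<^sup>1\<close> equals \<open>j q\<^sup>j - x (q\<^sup>j)'\<close>, in which the coefficient of \<open>x\<^sup>j\<close> cancels.\<close>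

lemma residue_deriv_mult_inverse_power:
  fixes p :: "'a::field_char_0 fps"
  assumes "p $ 0 \<noteq> 0"
  shows "(fps_deriv (fps_X * p) * inverse p ^ Suc j) $ j = (if j = 0 then 1 else 0)"
proof (cases j)
  case 0
  then show ?thesis using assms by simp
next
  case (Suc i)
  define q where "q = inverse p"
  have pq: "p * q = 1"
    using assms by (simp add: q_def inverse_mult_eq_1')
  have dq: "fps_deriv q = - fps_deriv p * q\<^sup>2"
    using assms by (simp add: q_def fps_inverse_deriv)
  have "of_nat j * (fps_deriv (fps_X * p) * q ^ Suc j)
      = of_nat j * (p * q) * q ^ j + of_nat j * (fps_X * (fps_deriv p * q\<^sup>2) * q ^ i)"
    by (simp add: Suc algebra_simps power2_eq_square)
  also have "\<dots> = of_nat j * q ^ j - fps_X * fps_deriv (q ^ j)"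
    unfolding fps_deriv_power' pq using Suc by (simp add: dq algebra_simps)
  also have "(of_nat j * q ^ j - fps_X * fps_deriv (q ^ j)) $ j = 0"
    by (simp add: Suc del: power_Suc of_nat_Suc flip: fps_of_nat)
  finally have "of_nat j * (fps_deriv (fps_X * p) * q ^ Suc j) $ j = (0 :: 'a)"
    by (simp flip: fps_of_nat)
  then show ?thesis
    using Suc by (simp add: q_def del: of_nat_Suc)
qed

theorem lagrange_buermann:
  fixes h p :: "'a::field_char_0 fps"
  assumes "p $ 0 \<noteq> 0" and "m > 0"
  shows "of_nat m * h $ m = (fps_deriv (h oo (fps_X * p)) * inverse p ^ m) $ (m - 1)"
proof -
  define f q where "f = fps_X * p" and "q = inverse p"
  have pq: "p * q = 1"
    using assms by (simp add: q_def inverse_mult_eq_1')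
  have f0: "f $ 0 = 0"
    by (simp add: f_def)
  have residue: "(f ^ n * (fps_deriv f * q ^ m)) $ (m - 1) = (if n = m - 1 then 1 else 0)"
    if "n \<le> m - 1" for n
  proof -
    have m: "m = n + Suc (m - 1 - n)"
      using that assms by simp
    have "f ^ n * (fps_deriv f * q ^ m)
        = fps_X ^ n * (p * q) ^ n * (fps_deriv f * q ^ Suc (m - 1 - n))"
      by (subst m) (simp add: f_def power_add power_mult_distrib mult_ac)
    also have "\<dots> = fps_X ^ n * (fps_deriv f * q ^ Suc (m - 1 - n))"
      by (simp add: pq)
    finally have "(f ^ n * (fps_deriv f * q ^ m)) $ (m - 1)
        = (fps_deriv f * q ^ Suc (m - 1 - n)) $ (m - 1 - n)"
      using that by (simp only: fps_X_power_mult_nth) auto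
    also have "\<dots> = (if m - 1 - n = 0 then 1 else 0)"
      unfolding f_def q_def by (rule residue_deriv_mult_inverse_power) fact
    finally show ?thesis using that by auto
  qed
  have "(fps_deriv (h oo f) * q ^ m) $ (m - 1)
      = (\<Sum>n=0..m - 1. fps_deriv h $ n * (f ^ n * (fps_deriv f * q ^ m)) $ (m - 1))"
    by (simp only: fps_compose_deriv[OF f0] mult.assoc fps_compose_mult_nth[OF f0])
  also have "\<dots> = (\<Sum>n=0..m - 1. fps_deriv h $ n * (if n = m - 1 then 1 else 0))"
    by (intro sum.cong refl) (simp only: residue atLeastAtMost_iff)
  also have "\<dots> = of_nat m * h $ m"
    using assms by (simp add: mult_delta_right del: of_nat_Suc)
  finally show ?thesis by (simp add: f_def q_def)
qed

corollary lagrange_inversion_power: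
  fixes f g :: "'a::field_char_0 fps"
  assumes "f $ 0 = 0" and "f $ 1 \<noteq> 0" and "g oo f = fps_X" and "m > 0" and "r > 0"
  shows "of_nat m * (g ^ r) $ m =
    (if r \<le> m then of_nat r * (inverse (fps_shift 1 f) ^ m) $ (m - r) else 0)"
proof -
  define p where "p = fps_shift 1 f"
  have f: "f = fps_X * p"
    using assms(1) by (simp add: fps_eq_iff p_def)
  have "g ^ r oo f = fps_X ^ r"
    using assms by (simp flip: fps_compose_power)
  moreover have "of_nat m * (g ^ r) $ m = (fps_deriv (g ^ r oo f) * inverse p ^ m) $ (m - 1)"
    unfolding f using assms by (intro lagrange_buermann) (simp_all add: p_def)
  ultimately have "of_nat m * (g ^ r) $ m
      = (fps_const (of_nat r) * (fps_X ^ (r - 1) * inverse p ^ m)) $ (m - 1)"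
    by (simp add: fps_deriv_power mult_ac)
  also have "\<dots> = of_nat r * (if m - 1 < r - 1 then 0 else (inverse p ^ m) $ (m - 1 - (r - 1)))"
    by (simp only: fps_mult_left_const_nth fps_X_power_mult_nth)
  finally show ?thesis
    using assms by (auto simp: p_def)
qed

lemma inverse_power_nth_binomial:
  fixes p :: "'a::field_char_0 fps"
  assumes "p $ 0 \<noteq> 0"
  defines "u \<equiv> p - fps_const (p $ 0)"
  shows "(inverse p ^ m) $ N =
    (\<Sum>k=0..N. (- of_nat m gchoose k) * inverse (p $ 0) ^ (m + k) * (u ^ k) $ N)"
proof -
  define c where "c = p $ 0"
  define v where "v = fps_const (inverse c) * u"
  have c: "c \<noteq> 0" and v0: "v $ 0 = 0"
    using assms by (simp_all add: c_def v_def)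
  have p: "p = fps_const c * (1 + v)"
    using c by (simp add: v_def u_def algebra_simps c_def[symmetric] flip: mult.assoc)
  have "inverse (1 + v) ^ m = inverse ((1 + fps_X) ^ m oo v)"
    using v0 by (simp add: fps_inverse_power fps_compose_add_distrib flip: fps_compose_power)
  also have "\<dots> = fps_binomial (- of_nat m) oo v"
    unfolding fps_binomial_minus_of_nat
    by (rule fps_inverse_compose [symmetric]) (use v0 in \<open>simp_all add: fps_power_zeroth\<close>)
  finally have "inverse p ^ m = fps_const (inverse c ^ m) * (fps_binomial (- of_nat m) oo v)"
    by (simp add: p fps_inverse_mult fps_const_inverse power_mult_distrib)
  then show ?thesis
    by (simp add: fps_compose_nth v_def power_mult_distrib sum_distrib_left power_add c_def mult_ac)
qed

definition fps_to_fract :: "'a::idom fps \<Rightarrow> 'a fract fps" where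
  "fps_to_fract f = Abs_fps (\<lambda>n. to_fract (f $ n))"

lemma fps_to_fract_nth [simp]: "fps_to_fract f $ n = to_fract (f $ n)"
  by (simp add: fps_to_fract_def)

lemma fps_to_fract_mult: "fps_to_fract (f * g) = fps_to_fract f * fps_to_fract g"
  by (simp add: fps_eq_iff fps_mult_nth)

lemma fps_to_fract_power: "fps_to_fract (f ^ k) = fps_to_fract f ^ k"
  by (induction k) (simp_all add: fps_to_fract_mult, simp add: fps_eq_iff)

lemma fps_to_fract_compose: "fps_to_fract (f oo g) = fps_to_fract f oo fps_to_fract g"
  by (simp add: fps_eq_iff fps_compose_nth flip: fps_to_fract_power)

lemma fps_to_fract_X: "fps_to_fract fps_X = fps_X"
  by (simp add: fps_eq_iff)

lemma de_moivre_nth: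
  fixes g :: "'a::comm_ring_1 fps"
  assumes "g $ 0 = 0"
  shows "de_moivre (int n) k (\<lambda>j. g $ j) = (g ^ k) $ n"
proof -
  have "Abs_fps (\<lambda>j. if j = 0 then 0 else g $ j) = g"
    using assms by (simp add: fps_eq_iff)
  then show ?thesis by (simp add: de_moivre_def)
qed

lemma to_fract_de_moivre_shift:
  fixes f :: "'a::idom fps"
  defines "p \<equiv> fps_shift 1 (fps_to_fract f)"
  shows "to_fract (de_moivre (int n) k (\<lambda>j. f $ (j + 1))) = ((p - fps_const (p $ 0)) ^ k) $ n"
proof -
  have "to_fract (de_moivre (int n) k (\<lambda>j. f $ (j + 1)))
      = (fps_to_fract (Abs_fps (\<lambda>j. if j = 0 then 0 else f $ (j + 1))) ^ k) $ n"
    by (simp add: de_moivre_def cong: if_cong flip: fps_to_fract_power)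
  also have "fps_to_fract (Abs_fps (\<lambda>j. if j = 0 then 0 else f $ (j + 1))) = p - fps_const (p $ 0)"
    by (simp add: fps_eq_iff p_def)
  finally show ?thesis .
qed

text \<open>When \<open>r > m\<close> both sides are zero: \<open>g\<^sup>r\<close> has no term of degree \<open>m\<close>, and the range of summation
  over the integers is empty.\<close>

lemma de_moivre_comp_inverse:
  fixes f g :: "'a::{idom, ring_char_0} fps"
  assumes f0: "f $ 0 = 0" and inv: "comp_inverse_fps f g" and m: "m > 0" and r: "r > 0"
  shows "to_fract (de_moivre (int m) r (\<lambda>j. g $ j)) =
           of_nat r / of_nat m *
           (\<Sum>k = 0..int m - int r.
              (- of_nat m gchoose nat k) * to_fract (f $ 1) powi (- int m - k) *
              to_fract (de_moivre (int m - int r) (nat k) (\<lambda>j. f $ (j + 1))))"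
    (is "_ = _ * (\<Sum>k = 0..int m - int r. ?t k)")
proof -
  define F G p where "F = fps_to_fract f" and "G = fps_to_fract g" and "p = fps_shift 1 F"
  have g0: "g $ 0 = 0" and gf: "g oo f = fps_X"
    using inv by (simp_all add: comp_inverse_fps_def)
  have GF: "G oo F = fps_X"
    by (simp add: F_def G_def gf fps_to_fract_X flip: fps_to_fract_compose)
  \<comment> \<open>Comparing coefficients of \<open>x\<close> in \<open>g(f(x)) = x\<close> gives \<open>b\<^sub>1 a\<^sub>1 = 1\<close>.\<close>
  have "(g oo f) $ 1 = g $ 1 * f $ 1"
    by (simp add: fps_compose_nth)
  then have f1: "f $ 1 \<noteq> 0"
    by (auto simp: gf)
  then have p0: "p $ 0 \<noteq> 0" and p0_eq: "p $ 0 = to_fract (f $ 1)"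
    by (simp_all add: p_def F_def)
  have "of_nat m * (G ^ r) $ m = (if r \<le> m then of_nat r * (inverse p ^ m) $ (m - r) else 0)"
    unfolding p_def using f0 f1 GF m r
    by (intro lagrange_inversion_power) (simp_all add: F_def)
  also have "\<dots> = of_nat r * (\<Sum>k = 0..int m - int r. ?t k)"
  proof (cases "r \<le> m")
    case True
    have pow: "to_fract (f $ 1) powi (- int m - int k) = inverse (p $ 0) ^ (m + k)" for k
    proof -
      have "- int m - int k = - int (m + k)" by simp
      then show ?thesis
        by (simp only: p0_eq power_int_minus power_int_of_nat power_inverse)
    qed
    have "(inverse p ^ m) $ (m - r) = (\<Sum>k = 0..m - r. ?t (int k))"
      unfolding inverse_power_nth_binomial[OF p0] pow of_nat_diff[OF True, symmetric]
        to_fract_de_moivre_shift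
      by (simp add: p_def F_def)
    also have "\<dots> = (\<Sum>k = 0..int m - int r. ?t k)"
      using True
      by (intro sum.reindex_bij_witness[of _ nat int]) auto
    finally show ?thesis using True by simp
  qed simp
  finally have "of_nat m * (G ^ r) $ m = of_nat r * (\<Sum>k = 0..int m - int r. ?t k)" .
  moreover have "to_fract (de_moivre (int m) r (\<lambda>j. g $ j)) = (G ^ r) $ m"
    by (simp add: de_moivre_nth[OF g0] G_def flip: fps_to_fract_power)
  ultimately show ?thesis
    using m by (simp add: field_simps)
qed

theorem corollary3p8:
  fixes f g :: "'a::{idom, ring_char_0} fps" and m r :: nat
  assumes "f $ 0 = 0"
    and "comp_inverse_fps f g"
    and "m > 0" and "r > 0"
  shows "to_fract (g $ m) =
           1 / of_nat m *
           (\<Sum>k = 0..int m - 1.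
              (- of_nat m gchoose nat k) * to_fract (f $ 1) powi (- int m - k) *
              to_fract (de_moivre (int m - 1) (nat k) (\<lambda>j. f $ (j + 1))))
       \<and> to_fract (de_moivre (int m) r (\<lambda>j. g $ j)) =
           of_nat r / of_nat m *
           (\<Sum>k = 0..int m - int r.
              (- of_nat m gchoose nat k) * to_fract (f $ 1) powi (- int m - k) *
              to_fract (de_moivre (int m - int r) (nat k) (\<lambda>j. f $ (j + 1))))"
proof -
  have "de_moivre (int m) 1 (\<lambda>j. g $ j) = g $ m"
    using assms(2) by (simp add: de_moivre_nth comp_inverse_fps_def)
  then show ?thesis
    using de_moivre_comp_inverse[OF assms(1-3), of 1] de_moivre_comp_inverse[OF assms] by simp
qed

end
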